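(* Let $\mathbb{F}_\theta^+$ be a 2-graph on a single vertex with generators $e_1,\dots,e_m$ and $f_1,\dots,f_n$, and let $\mathcal{O}_\theta$ be its graph C*-algebra. Then the mapping $\Psi:\mathcal{U}(\mathcal{O}_\theta)^2_{\rm twi}\to\mathrm{End}(\mathcal{O}_\theta)$, $(U,V)\mapsto\lambda_{(U,V)}$, where $\lambda_{(U,V)}$ is the unital endomorphism determined by $$\lambda_{(U,V)}(s_{e_i})=Us_{e_i},\qquad \lambda_{(U,V)}(s_{f_j})=Vs_{f_j}\qquad(i=1,\dots,m,\ j=1,\dots,n),$$ is a (well-defined) bijection. Its inverse is given by $$\lambda\mapsto\Big(\sum_{i=1}^m\lambda(s_{e_i})s_{e_i}^*,\ \sum_{j=1}^n\lambda(s_{f_j})s_{f_j}^*\Big).$$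
   Context: Let $\theta$ be a permutation of $\{1,\dots,m\}\times\{1,\dots,n\}$. The 2-graph on a single vertex $\mathbb{F}_\theta^+$ is the unital semigroup (identity $\varnothing$) generated by $e_1,\dots,e_m,f_1,\dots,f_n$, free in the $e_i$'s and free in the $f_j$'s, with the commutation relations $e_if_j=f_{j'}e_{i'}$ whenever $\theta(i,j)=(i',j')$. The degree of $w\in\mathbb{F}_\theta^+$ is $d(w)=(k,l)\in\mathbb{Z}_+^2$, where $k$, $l$ are the numbers of $e$'s and $f$'s in $w$ (independent of the factorization). $\mathcal{O}_\theta$ is the universal C*-algebra generated by isometries $\{s_u:u\in\mathbb{F}_\theta^+\}$ with $s_\varnothing=I$, $s_{uv}=s_us_v$, and $\sum_{i=1}^m s_{e_i}s_{e_i}^*=I=\sum_{j=1}^n s_{f_j}s_{f_j}^*$. $\mathrm{End}(\mathcal{O}_\theta)$ is the semigroup of unital endomorphisms of $\mathcal{O}_\theta$, and $\mathcal{U}(\mathcal{O}_\theta)$ is the set of unitaries of $\mathcal{O}_\theta$. Put $\lambda_{\epsilon_1}(X)=\sum_{i=1}^m s_{e_i}Xs_{e_i}^*$ and $\lambda_{\epsilon_2}(X)=\sum_{j=1}^n s_{f_j}Xs_{f_j}^*$ for $X\in\mathcal{O}_\theta$. Then $$\mathcal{U}(\mathcal{O}_\theta)^2_{\rm twi}=\{(U,V)\in\mathcal{U}(\mathcal{O}_\theta)\times\mathcal{U}(\mathcal{O}_\theta):\ U\lambda_{\epsilon_1}(V)=V\lambda_{\epsilon_2}(U)\}.$$ 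*)

theory Defs
  imports Complex_Main "HOL-Algebra.Algebra" "HOL-Algebra.Algebraic_Closure_Type"
    "HOL-Combinatorics.Permutations"
begin

section \<open>The semigroup of a 2-graph on a single vertex\<close>

datatype gen = E nat | F nat

definition words :: "nat \<Rightarrow> nat \<Rightarrow> gen list set" where
  "words m n = lists (E ` {1..m} \<union> F ` {1..n})"

inductive tg_step :: "nat \<Rightarrow> nat \<Rightarrow> (nat \<times> nat \<Rightarrow> nat \<times> nat) \<Rightarrow> gen list \<Rightarrow> gen list \<Rightarrow> bool"
  for m n \<theta> where
  "i \<in> {1..m} \<Longrightarrow> j \<in> {1..n} \<Longrightarrow> \<theta> (i, j) = (i', j') \<Longrightarrow>
     tg_step m n \<theta> (u @ [E i, F j] @ v) (u @ [F j', E i'] @ v)"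

definition tg_rel :: "nat \<Rightarrow> nat \<Rightarrow> (nat \<times> nat \<Rightarrow> nat \<times> nat) \<Rightarrow> (gen list \<times> gen list) set" where
  "tg_rel m n \<theta> = {(x, y). x \<in> words m n \<and> y \<in> words m n \<and> equivclp (tg_step m n \<theta>) x y}"

abbreviation tg_class ::
  "nat \<Rightarrow> nat \<Rightarrow> (nat \<times> nat \<Rightarrow> nat \<times> nat) \<Rightarrow> gen list \<Rightarrow> gen list set" where
  "tg_class m n \<theta> w \<equiv> tg_rel m n \<theta> `` {w}"

text \<open>The semigroup is the quotient of the free monoid on the generators by the congruence
  generated by the commutation relations.  No commutation relation involves only letters
  \<open>E i\<close> or only letters \<open>F j\<close>, so the semigroup is free in the \<open>E i\<close> and in the \<open>F j\<close>.\<close>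

definition two_graph ::
  "nat \<Rightarrow> nat \<Rightarrow> (nat \<times> nat \<Rightarrow> nat \<times> nat) \<Rightarrow> gen list set monoid" where
  "two_graph m n \<theta> =
     \<lparr> carrier = words m n // tg_rel m n \<theta>,
       monoid.mult = (\<lambda>u v. \<Union>x\<in>u. \<Union>y\<in>v. tg_class m n \<theta> (x @ y)),
       one = tg_class m n \<theta> [] \<rparr>"

abbreviation gen_e :: "nat \<Rightarrow> nat \<Rightarrow> (nat \<times> nat \<Rightarrow> nat \<times> nat) \<Rightarrow> nat \<Rightarrow> gen list set" where
  "gen_e m n \<theta> i \<equiv> tg_class m n \<theta> [E i]"

abbreviation gen_f :: "nat \<Rightarrow> nat \<Rightarrow> (nat \<times> nat \<Rightarrow> nat \<times> nat) \<Rightarrow> nat \<Rightarrow> gen list set" where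
  "gen_f m n \<theta> j \<equiv> tg_class m n \<theta> [F j]"

lemma words_append: "x \<in> words m n \<Longrightarrow> y \<in> words m n \<Longrightarrow> x @ y \<in> words m n"
  by (auto simp: words_def)

lemma equiv_tg_rel: "equiv (words m n) (tg_rel m n \<theta>)"
  by (rule equivI)
    (auto simp: tg_rel_def refl_on_def sym_def trans_def intro: equivclp_sym equivclp_trans)

lemma tg_step_context:
  assumes "tg_step m n \<theta> x y"
  shows "tg_step m n \<theta> (a @ x @ b) (a @ y @ b)"
  using assms
proof cases
  case (1 i j i' j' u v)
  then show ?thesis
    using tg_step.intros[of i m j n \<theta> i' j' "a @ u" "v @ b"] by simp
qed

lemma equivclp_tg_step_context:
  assumes "equivclp (tg_step m n \<theta>) x y"
  shows "equivclp (tg_step m n \<theta>) (a @ x @ b) (a @ y @ b)"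
  using assms
proof (induction rule: equivclp_induct)
  case base
  then show ?case by simp
next
  case (step y z)
  then have "equivclp (tg_step m n \<theta>) (a @ y @ b) (a @ z @ b)"
    by (metis r_into_equivclp equivclp_sym tg_step_context)
  with step.IH show ?case by (rule equivclp_trans)
qed

lemma tg_rel_append:
  assumes "(x, x') \<in> tg_rel m n \<theta>" "(y, y') \<in> tg_rel m n \<theta>"
  shows "(x @ y, x' @ y') \<in> tg_rel m n \<theta>"
proof -
  have "equivclp (tg_step m n \<theta>) (x @ y) (x' @ y)"
    using assms equivclp_tg_step_context[of m n \<theta> x x' "[]" y] by (auto simp: tg_rel_def)
  moreover have "equivclp (tg_step m n \<theta>) (x' @ y) (x' @ y')"
    using assms equivclp_tg_step_context[of m n \<theta> y y' x' "[]"] by (auto simp: tg_rel_def)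
  ultimately show ?thesis
    using assms by (auto simp: tg_rel_def words_append intro: equivclp_trans)
qed

lemma tg_class_mult:
  assumes "x \<in> words m n" "y \<in> words m n"
  shows "tg_class m n \<theta> x \<otimes>\<^bsub>two_graph m n \<theta>\<^esub> tg_class m n \<theta> y = tg_class m n \<theta> (x @ y)"
proof -
  note eq = equiv_tg_rel[of m n \<theta>]
  have "tg_class m n \<theta> (x' @ y') = tg_class m n \<theta> (x @ y)"
    if "x' \<in> tg_class m n \<theta> x" "y' \<in> tg_class m n \<theta> y" for x' y'
    using equiv_class_eq[OF eq tg_rel_append[of x x' m n \<theta> y y']] that by auto
  moreover have "x \<in> tg_class m n \<theta> x" "y \<in> tg_class m n \<theta> y"
    using equiv_class_self[OF eq] assms by blast+
  ultimately have "(\<Union>x'\<in>tg_class m n \<theta> x. \<Union>y'\<in>tg_class m n \<theta> y.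
      tg_class m n \<theta> (x' @ y')) = tg_class m n \<theta> (x @ y)"
    by blast
  then show ?thesis
    by (simp add: two_graph_def)
qed

lemma carrier_two_graph: "carrier (two_graph m n \<theta>) = tg_class m n \<theta> ` words m n"
  by (auto simp: two_graph_def quotient_def)

lemma monoid_two_graph: "monoid (two_graph m n \<theta>)"
proof -
  have one: "\<one>\<^bsub>two_graph m n \<theta>\<^esub> = tg_class m n \<theta> []" and nil: "[] \<in> words m n"
    by (simp_all add: two_graph_def words_def)
  show ?thesis
  proof (rule monoidI, unfold carrier_two_graph one)
    fix x y z
    assume "x \<in> tg_class m n \<theta> ` words m n" "y \<in> tg_class m n \<theta> ` words m n"
    then obtain x' y' where x: "x = tg_class m n \<theta> x'" "x' \<in> words m n"
      and y: "y = tg_class m n \<theta> y'" "y' \<in> words m n" by blast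
    show "x \<otimes>\<^bsub>two_graph m n \<theta>\<^esub> y \<in> tg_class m n \<theta> ` words m n"
      unfolding x(1) y(1) tg_class_mult[OF x(2) y(2)]
      by (rule imageI) (rule words_append[OF x(2) y(2)])
    assume "z \<in> tg_class m n \<theta> ` words m n"
    then obtain z' where z: "z = tg_class m n \<theta> z'" "z' \<in> words m n" by blast
    show "x \<otimes>\<^bsub>two_graph m n \<theta>\<^esub> y \<otimes>\<^bsub>two_graph m n \<theta>\<^esub> z =
        x \<otimes>\<^bsub>two_graph m n \<theta>\<^esub> (y \<otimes>\<^bsub>two_graph m n \<theta>\<^esub> z)"
      unfolding x(1) y(1) z(1) tg_class_mult[OF x(2) y(2)] tg_class_mult[OF y(2) z(2)]
        tg_class_mult[OF words_append[OF x(2) y(2)] z(2)]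
        tg_class_mult[OF x(2) words_append[OF y(2) z(2)]] append_assoc by (rule refl)
  next
    show "tg_class m n \<theta> [] \<in> tg_class m n \<theta> ` words m n"
      by (rule imageI[OF nil])
  next
    fix x assume "x \<in> tg_class m n \<theta> ` words m n"
    then obtain x' where x: "x = tg_class m n \<theta> x'" "x' \<in> words m n" by blast
    show "tg_class m n \<theta> [] \<otimes>\<^bsub>two_graph m n \<theta>\<^esub> x = x"
      unfolding x(1) tg_class_mult[OF nil x(2)] append_Nil by (rule refl)
    show "x \<otimes>\<^bsub>two_graph m n \<theta>\<^esub> tg_class m n \<theta> [] = x"
      unfolding x(1) tg_class_mult[OF x(2) nil] append_Nil2 by (rule refl)
  qed
qed


section \<open>C*-algebras\<close>

record 'a cstar = "(complex, 'a) module" +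
  adj :: "'a \<Rightarrow> 'a"
  nrm :: "'a \<Rightarrow> real"

definition tends_to :: "'a cstar \<Rightarrow> (nat \<Rightarrow> 'a) \<Rightarrow> 'a \<Rightarrow> bool" where
  "tends_to A a x \<longleftrightarrow> (\<lambda>k. nrm A (a k \<ominus>\<^bsub>A\<^esub> x)) \<longlonglongrightarrow> 0"

text \<open>Nonzero unital complex C*-algebras.\<close>

locale cstar_algebra = ring A + module "ring_of_type_algebra :: complex ring" A
  for A :: "'a cstar" (structure) +
  assumes one_not_zero: "\<one> \<noteq> \<zero>"
    and smult_mult_left: "\<lbrakk>x \<in> carrier A; y \<in> carrier A\<rbrakk> \<Longrightarrow> (c \<odot> x) \<otimes> y = c \<odot> (x \<otimes> y)"
    and smult_mult_right: "\<lbrakk>x \<in> carrier A; y \<in> carrier A\<rbrakk> \<Longrightarrow> x \<otimes> (c \<odot> y) = c \<odot> (x \<otimes> y)"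
    and adj_closed: "x \<in> carrier A \<Longrightarrow> adj A x \<in> carrier A"
    and adj_adj: "x \<in> carrier A \<Longrightarrow> adj A (adj A x) = x"
    and adj_add: "\<lbrakk>x \<in> carrier A; y \<in> carrier A\<rbrakk> \<Longrightarrow> adj A (x \<oplus> y) = adj A x \<oplus> adj A y"
    and adj_mult: "\<lbrakk>x \<in> carrier A; y \<in> carrier A\<rbrakk> \<Longrightarrow> adj A (x \<otimes> y) = adj A y \<otimes> adj A x"
    and adj_smult: "x \<in> carrier A \<Longrightarrow> adj A (c \<odot> x) = cnj c \<odot> adj A x"
    and nrm_nonneg: "x \<in> carrier A \<Longrightarrow> 0 \<le> nrm A x"
    and nrm_eq_zero: "x \<in> carrier A \<Longrightarrow> nrm A x = 0 \<longleftrightarrow> x = \<zero>"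
    and nrm_triangle: "\<lbrakk>x \<in> carrier A; y \<in> carrier A\<rbrakk> \<Longrightarrow> nrm A (x \<oplus> y) \<le> nrm A x + nrm A y"
    and nrm_smult: "x \<in> carrier A \<Longrightarrow> nrm A (c \<odot> x) = cmod c * nrm A x"
    and nrm_mult: "\<lbrakk>x \<in> carrier A; y \<in> carrier A\<rbrakk> \<Longrightarrow> nrm A (x \<otimes> y) \<le> nrm A x * nrm A y"
    and cstar_identity: "x \<in> carrier A \<Longrightarrow> nrm A (adj A x \<otimes> x) = (nrm A x)\<^sup>2"
    and complete: "\<lbrakk>range a \<subseteq> carrier A;
          \<forall>e>0. \<exists>N. \<forall>j\<ge>N. \<forall>k\<ge>N. nrm A (a j \<ominus> a k) < e\<rbrakk>
        \<Longrightarrow> \<exists>x\<in>carrier A. tends_to A a x"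

definition cstar_subalgebra :: "'a set \<Rightarrow> 'a cstar \<Rightarrow> bool" where
  "cstar_subalgebra S A \<longleftrightarrow>
     S \<subseteq> carrier A \<and> \<one>\<^bsub>A\<^esub> \<in> S \<and>
     (\<forall>x\<in>S. \<forall>y\<in>S. x \<oplus>\<^bsub>A\<^esub> y \<in> S \<and> x \<otimes>\<^bsub>A\<^esub> y \<in> S) \<and>
     (\<forall>c. \<forall>x\<in>S. c \<odot>\<^bsub>A\<^esub> x \<in> S) \<and>
     (\<forall>x\<in>S. adj A x \<in> S) \<and>
     (\<forall>a x. range a \<subseteq> S \<and> x \<in> carrier A \<and> tends_to A a x \<longrightarrow> x \<in> S)"

text \<open>Unital *-homomorphisms.  They are taken to be \<open>undefined\<close> off the carrier, so that
  equality of homomorphisms is equality on the carrier.\<close>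

definition star_hom :: "'a cstar \<Rightarrow> 'b cstar \<Rightarrow> ('a \<Rightarrow> 'b) set" where
  "star_hom A B =
     {\<phi> \<in> ring_hom A B \<inter> extensional (carrier A).
        (\<forall>c. \<forall>x\<in>carrier A. \<phi> (c \<odot>\<^bsub>A\<^esub> x) = c \<odot>\<^bsub>B\<^esub> \<phi> x) \<and>
        (\<forall>x\<in>carrier A. \<phi> (adj A x) = adj B (\<phi> x))}"

abbreviation End_alg :: "'a cstar \<Rightarrow> ('a \<Rightarrow> 'a) set" where
  "End_alg A \<equiv> star_hom A A"

definition isometries :: "'a cstar \<Rightarrow> 'a set" where
  "isometries A = {v \<in> carrier A. adj A v \<otimes>\<^bsub>A\<^esub> v = \<one>\<^bsub>A\<^esub>}"

definition unitaries :: "'a cstar \<Rightarrow> 'a set" where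
  "unitaries A =
     {v \<in> carrier A. adj A v \<otimes>\<^bsub>A\<^esub> v = \<one>\<^bsub>A\<^esub> \<and> v \<otimes>\<^bsub>A\<^esub> adj A v = \<one>\<^bsub>A\<^esub>}"


section \<open>The graph C*-algebra\<close>

definition cuntz_family :: "nat \<Rightarrow> nat \<Rightarrow> (nat \<times> nat \<Rightarrow> nat \<times> nat) \<Rightarrow> 'a cstar \<Rightarrow>
    (gen list set \<Rightarrow> 'a) \<Rightarrow> bool" where
  "cuntz_family m n \<theta> A s \<longleftrightarrow>
     (\<forall>u\<in>carrier (two_graph m n \<theta>). s u \<in> isometries A) \<and>
     s \<one>\<^bsub>two_graph m n \<theta>\<^esub> = \<one>\<^bsub>A\<^esub> \<and>
     (\<forall>u\<in>carrier (two_graph m n \<theta>). \<forall>v\<in>carrier (two_graph m n \<theta>).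
        s (u \<otimes>\<^bsub>two_graph m n \<theta>\<^esub> v) = s u \<otimes>\<^bsub>A\<^esub> s v) \<and>
     (\<Oplus>\<^bsub>A\<^esub>i\<in>{1..m}. s (gen_e m n \<theta> i) \<otimes>\<^bsub>A\<^esub> adj A (s (gen_e m n \<theta> i))) = \<one>\<^bsub>A\<^esub> \<and>
     (\<Oplus>\<^bsub>A\<^esub>j\<in>{1..n}. s (gen_f m n \<theta> j) \<otimes>\<^bsub>A\<^esub> adj A (s (gen_f m n \<theta> j))) = \<one>\<^bsub>A\<^esub>"

text \<open>\<open>A\<close> together with \<open>s\<close> is the universal C*-algebra generated by such a family.

  The test algebras \<open>B\<close> range over all C*-algebra structures on all subsets of the type \<open>'a\<close>.
  This is as strong as testing against every C*-algebra.  Indeed \<open>A\<close> contains a copy of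
  the complex numbers, so \<open>'a\<close> has at least the cardinality of the continuum; and a family \<open>t\<close> in any
  C*-algebra takes its values in the C*-subalgebra that it generates, which is separable,
  hence has at most the cardinality of the continuum and is isomorphic to some \<open>B\<close> as below.\<close>

definition graph_cstar :: "nat \<Rightarrow> nat \<Rightarrow> (nat \<times> nat \<Rightarrow> nat \<times> nat) \<Rightarrow> 'a cstar \<Rightarrow>
    (gen list set \<Rightarrow> 'a) \<Rightarrow> bool" where
  "graph_cstar m n \<theta> A s \<longleftrightarrow>
     cstar_algebra A \<and> cuntz_family m n \<theta> A s \<and>
     (\<forall>S. cstar_subalgebra S A \<and> s ` carrier (two_graph m n \<theta>) \<subseteq> S \<longrightarrow> S = carrier A) \<and>
     (\<forall>(B :: 'a cstar) t. cstar_algebra B \<and> cuntz_family m n \<theta> B t \<longrightarrow>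
        (\<exists>!\<pi>. \<pi> \<in> star_hom A B \<and> (\<forall>u\<in>carrier (two_graph m n \<theta>). \<pi> (s u) = t u)))"

definition lambda_e1 :: "nat \<Rightarrow> nat \<Rightarrow> (nat \<times> nat \<Rightarrow> nat \<times> nat) \<Rightarrow> 'a cstar \<Rightarrow>
    (gen list set \<Rightarrow> 'a) \<Rightarrow> 'a \<Rightarrow> 'a" where
  "lambda_e1 m n \<theta> A s x =
     (\<Oplus>\<^bsub>A\<^esub>i\<in>{1..m}. s (gen_e m n \<theta> i) \<otimes>\<^bsub>A\<^esub> x \<otimes>\<^bsub>A\<^esub> adj A (s (gen_e m n \<theta> i)))"

definition lambda_e2 :: "nat \<Rightarrow> nat \<Rightarrow> (nat \<times> nat \<Rightarrow> nat \<times> nat) \<Rightarrow> 'a cstar \<Rightarrow>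
    (gen list set \<Rightarrow> 'a) \<Rightarrow> 'a \<Rightarrow> 'a" where
  "lambda_e2 m n \<theta> A s x =
     (\<Oplus>\<^bsub>A\<^esub>j\<in>{1..n}. s (gen_f m n \<theta> j) \<otimes>\<^bsub>A\<^esub> x \<otimes>\<^bsub>A\<^esub> adj A (s (gen_f m n \<theta> j)))"

definition U2_twi :: "nat \<Rightarrow> nat \<Rightarrow> (nat \<times> nat \<Rightarrow> nat \<times> nat) \<Rightarrow> 'a cstar \<Rightarrow>
    (gen list set \<Rightarrow> 'a) \<Rightarrow> ('a \<times> 'a) set" where
  "U2_twi m n \<theta> A s =
     {(U, V) \<in> unitaries A \<times> unitaries A.
        U \<otimes>\<^bsub>A\<^esub> lambda_e1 m n \<theta> A s V = V \<otimes>\<^bsub>A\<^esub> lambda_e2 m n \<theta> A s U}"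

definition is_lambda_UV :: "nat \<Rightarrow> nat \<Rightarrow> (nat \<times> nat \<Rightarrow> nat \<times> nat) \<Rightarrow> 'a cstar \<Rightarrow>
    (gen list set \<Rightarrow> 'a) \<Rightarrow> 'a \<Rightarrow> 'a \<Rightarrow> ('a \<Rightarrow> 'a) \<Rightarrow> bool" where
  "is_lambda_UV m n \<theta> A s U V \<phi> \<longleftrightarrow>
     \<phi> \<in> End_alg A \<and>
     (\<forall>i\<in>{1..m}. \<phi> (s (gen_e m n \<theta> i)) = U \<otimes>\<^bsub>A\<^esub> s (gen_e m n \<theta> i)) \<and>
     (\<forall>j\<in>{1..n}. \<phi> (s (gen_f m n \<theta> j)) = V \<otimes>\<^bsub>A\<^esub> s (gen_f m n \<theta> j))"

definition Psi :: "nat \<Rightarrow> nat \<Rightarrow> (nat \<times> nat \<Rightarrow> nat \<times> nat) \<Rightarrow> 'a cstar \<Rightarrow>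
    (gen list set \<Rightarrow> 'a) \<Rightarrow> 'a \<times> 'a \<Rightarrow> 'a \<Rightarrow> 'a" where
  "Psi m n \<theta> A s = (\<lambda>(U, V). THE \<phi>. is_lambda_UV m n \<theta> A s U V \<phi>)"

end

theory Submission
  imports Defs "HOL-Computational_Algebra.Polynomial"
begin

text \<open>Isometries whose range projections sum to the identity have orthogonal ranges.  Hence
  \<open>U = \<Sum>\<^sub>i w\<^sub>i v\<^sub>i*\<close> is the unique element with \<open>U v\<^sub>i = w\<^sub>i\<close> for two such families \<open>v\<close>, \<open>w\<close>, and it is
  unitary.  For \<open>w = \<phi> v\<close> this recovers \<open>(U, V)\<close> from an endomorphism \<open>\<phi>\<close>.  Conversely, the equation
  \<open>U \<lambda>\<^sub>1(V) = V \<lambda>\<^sub>2(U)\<close> says exactly that the isometries \<open>U s(e\<^sub>i)\<close>, \<open>V s(f\<^sub>j)\<close> satisfy the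
  commutation relations of the semigroup, so the universal property, applied with the algebra itself
  as target, yields \<open>\<phi>\<close>.

  Orthogonality of the ranges needs that positive elements with sum \<open>0\<close> vanish.  This reduces to
  the fact that a self-adjoint \<open>x\<close> with \<open>1 + x\<close> and \<open>1 - x\<close> of norm at most \<open>1\<close> is \<open>0\<close>: these bounds
  self-improve to the same bounds for \<open>3/2 x\<close>, and iterating shrinks the norm of \<open>x\<close> to \<open>0\<close>.\<close>

section \<open>Seminorms on polynomials\<close>

text \<open>\<open>N p\<close> will be the norm of \<open>p(x)\<close> for a self-adjoint \<open>x\<close>.  By convexity and products,
  the bounds on \<open>1 + t x\<close> and \<open>1 - t x\<close> give a bound on \<open>1 + 3 t\<^sup>2 x\<^sup>2\<close>, hence by the
  C*-identity on \<open>1 + i sqrt 3 t x\<close> and \<open>1 - i sqrt 3 t x\<close>; averaging squares of such factors cancels the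
  quadratic term and leaves a linear term larger than \<open>t x\<close>.\<close>

lemma poly_seminorm_rescale:
  fixes N :: "complex poly \<Rightarrow> real" and t :: real
  assumes add: "\<And>p q. N (p + q) \<le> N p + N q"
    and smult: "\<And>c p. N (Polynomial.smult c p) = cmod c * N p"
    and mult: "\<And>p q. N (p * q) \<le> N p * N q"
    and star: "\<And>p. N (map_poly cnj p * p) = (N p)\<^sup>2"
    and plus: "N [:1, of_real t:] \<le> 1" and minus: "N [:1, - of_real t:] \<le> 1"
  shows "N [:1, of_real (3 / 2 * t):] \<le> 1"
proof -
  define x where "x = [:0, complex_of_real t:]"
  \<comment> \<open>\<open>N\<close> vanishes at 0 and is even, so splitting 0 as \<open>p\<close>
    plus its negative gives 0 \<le> 2 \<open>N p\<close>.\<close>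
  have N0: "0 \<le> N p" for p
  proof -
    have "N (Polynomial.smult 0 p) = 0" by (simp only: smult) simp
    moreover have "N (Polynomial.smult (-1) p) = N p" by (simp only: smult) simp
    moreover have "p + Polynomial.smult (-1) p = Polynomial.smult 0 p" by simp
    ultimately show ?thesis using add[of p "Polynomial.smult (-1) p"] by simp
  qed
  \<comment> \<open>The unit ball of \<open>N\<close> is closed under products and, by
    \<open>mid\<close>, under midpoints; apart from the appeal to \<open>star\<close>, every bound
    below comes from these two closures.\<close>
  have prod: "N (p * q) \<le> 1" if "N p \<le> 1" "N q \<le> 1" for p q
    using mult[of p q] mult_mono[of "N p" 1 "N q" 1] that N0 by (simp add: order_trans)
  have mid: "N r \<le> 1" if "p + q = 2 * r" "N p \<le> 1" "N q \<le> 1" for p q r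
  proof -
    have "N (Polynomial.smult 2 r) \<le> N p + N q"
      using add[of p q] that(1) by (simp add: numeral_poly)
    with that show ?thesis by (simp only: smult) simp
  qed
  define y where "y = [:0, complex_of_real t / 2:]"
  \<comment> \<open>The coefficient is purely imaginary, so conjugation exchanges
    \<open>1 + v\<close> and \<open>1 - v\<close>; the factor \<open>sqrt 3\<close> makes their
    product \<open>1 + 3 * x\<^sup>2\<close>.\<close>
  define v where "v = [:0, \<i> * of_real (sqrt 3 * t):]"
  have x: "x = 2 * y"
    by (simp add: x_def y_def numeral_poly)
  have "(complex_of_real (sqrt 3))\<^sup>2 = 3"
    by (simp flip: of_real_power)
  then have "(\<i> * complex_of_real (sqrt 3 * t))\<^sup>2 = - 3 * (complex_of_real t)\<^sup>2"
    by (simp add: power_mult_distrib)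
  then have v: "v * v = - 3 * x\<^sup>2"
    by (simp add: x_def v_def numeral_poly power2_eq_square)
  have p: "N (1 + x) \<le> 1" and m: "N (1 - x) \<le> 1"
    using plus minus by (simp_all add: x_def one_pCons)
  note p2 = prod[OF p p] and m2 = prod[OF m m]
  have "N (1 + x\<^sup>2) \<le> 1"
    by (rule mid[OF _ p2 m2]) (simp add: algebra_simps power2_eq_square)
  from prod[OF this prod[OF m p]] have q: "N (1 - x^4) \<le> 1"
    by (simp add: algebra_simps power2_eq_square numeral_eq_Suc)
  \<comment> \<open>This is the midpoint of the fourth powers of \<open>1 + x\<close> and
    \<open>1 - x\<close>; its own midpoint with \<open>1 - x^4\<close> is
    \<open>1 + 3 * x\<^sup>2\<close>.\<close>
  have "N (1 + 6 * x\<^sup>2 + x^4) \<le> 1"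
    by (rule mid[OF _ prod[OF p2 p2] prod[OF m2 m2]])
      (simp add: algebra_simps power2_eq_square numeral_eq_Suc)
  from mid[OF _ this q] have x3: "N (1 + 3 * x\<^sup>2) \<le> 1"
    by simp
  have conj: "map_poly cnj (1 + v) = 1 - v" "map_poly cnj (1 - v) = 1 + v"
    by (simp_all add: v_def one_pCons map_poly_pCons)
  have "(1 - v) * (1 + v) = 1 + 3 * x\<^sup>2" "(1 + v) * (1 - v) = 1 + 3 * x\<^sup>2"
    using v by (simp_all add: algebra_simps)
  then have w: "N (1 + v) \<le> 1" "N (1 - v) \<le> 1"
    using star[of "1 + v"] star[of "1 - v"] x3 unfolding conj by (simp_all add: power_le_one_iff N0)
  have "N (1 - 3 * x\<^sup>2) \<le> 1"
    by (rule mid[OF _ prod[OF w(1) w(1)] prod[OF w(2) w(2)]]) (simp add: algebra_simps v)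
  \<comment> \<open>Two midpoints with the square of \<open>1 + x\<close>, starting from
    \<open>1 - 3 * x\<^sup>2\<close>, cancel the quadratic term and leave \<open>1 + 3 * y\<close>,
    whose linear term is 3/2 of \<open>x\<close>.\<close>
  from mid[OF _ p2 this] have "N (1 + x - x\<^sup>2) \<le> 1"
    by (simp add: algebra_simps power2_eq_square)
  from mid[OF _ p2 this] have "N (1 + 3 * y) \<le> 1"
    by (simp add: algebra_simps power2_eq_square x)
  then show ?thesis
    by (simp add: y_def one_pCons numeral_poly mult.commute)
qed

text \<open>Rescaling both \<open>t\<close> and \<open>- t\<close> preserves the pair of bounds, so
  after \<open>k\<close> rounds it holds for \<open>(3/2)^k\<close>. Then
  \<open>(3/2)^k * N [:0, 1:]\<close> stays bounded in \<open>k\<close>, which excludes a positive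
  value.\<close>

lemma poly_seminorm_zero:
  fixes N :: "complex poly \<Rightarrow> real"
  assumes add: "\<And>p q. N (p + q) \<le> N p + N q"
    and smult: "\<And>c p. N (Polynomial.smult c p) = cmod c * N p"
    and mult: "\<And>p q. N (p * q) \<le> N p * N q"
    and star: "\<And>p. N (map_poly cnj p * p) = (N p)\<^sup>2"
    and plus: "N [:1, 1:] \<le> 1" and minus: "N [:1, - 1:] \<le> 1"
  shows "N [:0, 1:] \<le> 0"
proof (rule ccontr)
  assume "\<not> N [:0, 1:] \<le> 0"
  then have pos: "0 < N [:0, 1:]" by simp
  have *: "N [:1, of_real ((3/2)^k):] \<le> 1 \<and> N [:1, of_real (- ((3/2)^k)):] \<le> 1" for k
  proof (induction k)
    case 0
    then show ?case using plus minus by simp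
  next
    case (Suc k)
    then show ?case
      using poly_seminorm_rescale[of N "(3/2)^k", OF add smult mult star]
        poly_seminorm_rescale[of N "- ((3/2)^k)", OF add smult mult star] by simp
  qed
  have "(3/2)^k * N [:0, 1:] \<le> 1" for k
  proof -
    \<comment> \<open>Half the difference of the two polynomials bounded in \<open>*\<close>
      isolates the linear term.\<close>
    have "[:0, complex_of_real ((3/2)^k):] = Polynomial.smult (1/2) [:1, of_real ((3/2)^k):] +
        Polynomial.smult (-1/2) [:1, of_real (- ((3/2)^k)):]"
      by (simp add: field_simps)
    then have "N [:0, of_real ((3/2)^k):] \<le> 1/2 * N [:1, of_real ((3/2)^k):] +
        1/2 * N [:1, of_real (- ((3/2)^k)):]"
      using add[of "Polynomial.smult (1/2) [:1, of_real ((3/2)^k):]"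
        "Polynomial.smult (-1/2) [:1, of_real (- ((3/2)^k)):]"]
      by (simp only: smult) simp
    also have "\<dots> \<le> 1" using *[of k] by simp
    finally show ?thesis
      using smult[of "of_real ((3/2)^k)" "[:0, 1:]"] by (simp add: norm_power norm_divide)
  qed
  moreover obtain k where "1 / N [:0, 1:] < (3/2)^k"
    using real_arch_pow[of "3/2" "1 / N [:0, 1:]"] by auto
  ultimately show False
    using pos by (metis divide_less_eq linorder_not_le)
qed

section \<open>C*-algebras and Cuntz families of isometries\<close>

lemma star_homD:
  assumes "\<phi> \<in> star_hom A B" "x \<in> carrier A"
  shows "\<phi> x \<in> carrier B" "y \<in> carrier A \<Longrightarrow> \<phi> (x \<otimes>\<^bsub>A\<^esub> y) = \<phi> x \<otimes>\<^bsub>B\<^esub> \<phi> y"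
    and "y \<in> carrier A \<Longrightarrow> \<phi> (x \<oplus>\<^bsub>A\<^esub> y) = \<phi> x \<oplus>\<^bsub>B\<^esub> \<phi> y"
    and "\<phi> (adj A x) = adj B (\<phi> x)" "\<phi> \<one>\<^bsub>A\<^esub> = \<one>\<^bsub>B\<^esub>" "\<phi> (c \<odot>\<^bsub>A\<^esub> x) = c \<odot>\<^bsub>B\<^esub> \<phi> x"
  using assms by (auto simp: star_hom_def ring_hom_def)

context cstar_algebra
begin

text \<open>The scalar ring is a locale parent as well and shadows the unqualified ring laws.\<close>

lemma ring_A: "ring A"
  using cstar_algebra_axioms by (simp add: cstar_algebra_def)

lemmas A_closed = ring.ring_simprules(1-6)[OF ring_A]
lemmas A_assoc = ring.ring_simprules(11)[OF ring_A]
lemmas A_neg_cancel = ring.ring_simprules(18)[OF ring_A]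
lemmas A_ring = ring.ring_simprules(7,9-11,13,14,16-19,22,23,26,27)[OF ring_A]

section \<open>Elementary laws of scalars, adjoint and norm\<close>

lemma smult_in [simp, intro]: "x \<in> carrier A \<Longrightarrow> c \<odot> x \<in> carrier A"
  using smult_closed[of c x] by (simp add: ring_of_type_algebra_def)

lemma add_smult: "x \<in> carrier A \<Longrightarrow> (c + d) \<odot> x = c \<odot> x \<oplus> d \<odot> x"
  using smult_l_distr[of c d x] by (simp add: ring_of_type_algebra_def)

lemma smult_add: "x \<in> carrier A \<Longrightarrow> y \<in> carrier A \<Longrightarrow> c \<odot> (x \<oplus> y) = c \<odot> x \<oplus> c \<odot> y"
  using smult_r_distr[of c x y] by (simp add: ring_of_type_algebra_def)

lemma smult_smult: "x \<in> carrier A \<Longrightarrow> c \<odot> (d \<odot> x) = (c * d) \<odot> x"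
  using smult_assoc1[of c d x] by (simp add: ring_of_type_algebra_def)

lemma one_smult [simp]: "x \<in> carrier A \<Longrightarrow> 1 \<odot> x = x"
  using smult_one[of x] by (simp add: ring_of_type_algebra_def)

lemma zero_smult [simp]: "x \<in> carrier A \<Longrightarrow> 0 \<odot> x = \<zero>"
  using smult_l_null[of x] by (simp add: ring_of_type_algebra_def)

lemma smult_zero [simp]: "c \<odot> \<zero> = \<zero>"
  using smult_r_null[of c] by (simp add: ring_of_type_algebra_def)

lemma minus_one_smult: "x \<in> carrier A \<Longrightarrow> (- 1) \<odot> x = \<ominus> x"
  using add_smult[of x "-1" 1]
  by (simp add: abelian_group.minus_equality[OF ring.is_abelian_group[OF ring_A]])

lemma adj_in [simp, intro]: "x \<in> carrier A \<Longrightarrow> adj A x \<in> carrier A"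
  by (rule adj_closed)

lemma adj_one [simp]: "adj A \<one> = \<one>"
  using adj_mult[of "adj A \<one>" \<one>] adj_adj[of \<one>] by simp

lemma adj_zero [simp]: "adj A \<zero> = \<zero>"
  using adj_smult[of \<one> 0] by simp

lemma adj_finsum:
  assumes "finite I" "\<And>i. i \<in> I \<Longrightarrow> f i \<in> carrier A"
  shows "adj A (\<Oplus>i\<in>I. f i) = (\<Oplus>i\<in>I. adj A (f i))"
  using assms by (induction I rule: finite_induct) (auto simp: adj_add Pi_def)

lemma nrm_one [simp]: "nrm A \<one> = 1"
proof -
  have "nrm A \<one> = (nrm A \<one>)\<^sup>2" using cstar_identity[of \<one>] by simp
  moreover have "nrm A \<one> \<noteq> 0" using nrm_eq_zero[of \<one>] one_not_zero by simp
  ultimately show ?thesis by (simp add: power2_eq_square)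
qed

lemma nrm_zero [simp]: "nrm A \<zero> = 0"
  by (simp add: nrm_eq_zero)

text \<open>The C*-identity and submultiplicativity bound the square of \<open>nrm A y\<close> by
  \<open>nrm A (adj A y) * nrm A y\<close>. Cancelling gives one inequality, and the same for the
  adjoint gives the other.\<close>

lemma nrm_adj: "x \<in> carrier A \<Longrightarrow> nrm A (adj A x) = nrm A x"
proof -
  have *: "nrm A y \<le> nrm A (adj A y)" if y: "y \<in> carrier A" for y
  proof (cases "nrm A y = 0")
    case False
    then show ?thesis
      using cstar_identity[OF y] nrm_mult[of "adj A y" y] nrm_nonneg[OF y] y
      by (simp add: power2_eq_square)
  qed (use y nrm_nonneg in simp)
  show "x \<in> carrier A \<Longrightarrow> nrm A (adj A x) = nrm A x"
    using *[of x] *[of "adj A x"] by (simp add: adj_adj)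
qed

lemma nrm_isometry: "v \<in> isometries A \<Longrightarrow> nrm A v = 1"
  using cstar_identity[of v] nrm_nonneg[of v]
  by (auto simp: isometries_def power2_eq_1_iff)

section \<open>Polynomials evaluated at an element\<close>

text \<open>Horner evaluation, with constants embedded as multiples of \<open>\<one>\<close>; it
  pulls the norm of \<open>A\<close> back to a seminorm on \<open>complex poly\<close>.\<close>

definition peval :: "'a \<Rightarrow> complex poly \<Rightarrow> 'a" where
  "peval x p = fold_coeffs (\<lambda>c y. c \<odot> \<one> \<oplus> x \<otimes> y) p \<zero>"

lemma peval_0 [simp]: "peval x 0 = \<zero>"
  by (simp add: peval_def)

lemma peval_pCons [simp]:
  assumes "x \<in> carrier A"
  shows "peval x (pCons c p) = c \<odot> \<one> \<oplus> x \<otimes> peval x p"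
  using assms by (cases "p = 0"; cases "c = 0") (simp_all add: peval_def)

lemma peval_closed [simp]: "x \<in> carrier A \<Longrightarrow> peval x p \<in> carrier A"
  by (induction p) auto

lemma peval_add:
  assumes x: "x \<in> carrier A"
  shows "peval x (p + q) = peval x p \<oplus> peval x q"
  using x by (induction p q rule: poly_induct2) (simp_all add: add_smult A_ring)

lemma peval_smult:
  assumes x: "x \<in> carrier A"
  shows "peval x (Polynomial.smult c p) = c \<odot> peval x p"
  using x by (induction p) (simp_all add: smult_add smult_smult smult_mult_right)

lemma peval_mult:
  assumes x: "x \<in> carrier A"
  shows "peval x (p * q) = peval x p \<otimes> peval x q"
  using x by (induction p)
    (simp_all add: peval_add peval_smult A_ring smult_mult_left)

lemma peval_adj:
  assumes x: "x \<in> carrier A" and sa: "adj A x = x"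
  shows "peval x (map_poly cnj p) = adj A (peval x p)"
proof (induction p)
  case (pCons c p)
  \<comment> \<open>The adjoint reverses the product in the Horner step, so \<open>x\<close> has to
    be moved past a polynomial in itself.\<close>
  have "x \<otimes> y = y \<otimes> x" if "y = peval x q" for q y
    unfolding that
  proof (induction q)
    case (pCons a q)
    have "x \<otimes> (x \<otimes> peval x q) = x \<otimes> peval x q \<otimes> x"
      using A_assoc[of x "peval x q" x] pCons x by simp
    then show ?case
      using x by (simp add: A_ring smult_mult_left smult_mult_right)
  qed (simp add: x)
  then have "x \<otimes> peval x (map_poly cnj p) = peval x (map_poly cnj p) \<otimes> x" by blast
  with pCons show ?case
    using x by (simp add: map_poly_pCons adj_add adj_smult adj_mult sa)
qed simp

text \<open>The map sending \<open>p\<close> to \<open>nrm A (peval x p)\<close> satisfies the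
  hypotheses of \<open>poly_seminorm_zero\<close>. Self-adjointness enters through
  \<open>peval_adj\<close>, which turns the C*-identity into the condition on conjugated
  coefficients.\<close>

lemma selfadjoint_eq_zero:
  assumes x: "x \<in> carrier A" and sa: "adj A x = x"
    and "nrm A (\<one> \<oplus> x) \<le> 1" "nrm A (\<one> \<ominus> x) \<le> 1"
  shows "x = \<zero>"
proof -
  have "nrm A (peval x [:0, 1:]) \<le> 0"
    using x assms(3,4)
    by (intro poly_seminorm_zero)
      (simp_all add: peval_add peval_smult peval_mult peval_adj[OF x sa] nrm_triangle nrm_smult
        nrm_mult cstar_identity minus_one_smult A_ring del: mult_pCons_left mult_pCons_right)
  then show ?thesis
    using nrm_eq_zero[OF x] nrm_nonneg[OF x] x by simp
qed


section \<open>Finite sums and positivity\<close>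

lemma semiring_A: "semiring A"
  by unfold_locales

lemma abelian_monoid_A: "abelian_monoid A"
  by (rule semiring.axioms[OF semiring_A])

lemmas A_finsum_ldistr = semiring.finsum_ldistr[OF semiring_A]
lemmas A_finsum_rdistr = semiring.finsum_rdistr[OF semiring_A]
lemmas A_finsum_cong' = abelian_monoid.finsum_cong'[OF abelian_monoid_A]
lemmas A_finsum_insert = abelian_monoid.finsum_insert[OF abelian_monoid_A]
lemmas A_finsum_empty = abelian_monoid.finsum_empty[OF abelian_monoid_A]
lemmas A_finsum_singleton = abelian_monoid.finsum_singleton[OF abelian_monoid_A]
lemmas A_finsum_closed [simp, intro] = abelian_monoid.finsum_closed[OF abelian_monoid_A]

text \<open>For self-adjoint elements this is positivity, expressed by the norm so that neither the
  spectrum nor functional calculus is needed.\<close>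

definition norm_positive :: "'a \<Rightarrow> bool" where
  "norm_positive a \<longleftrightarrow>
     a \<in> carrier A \<and> (\<exists>K\<ge>0. nrm A (complex_of_real K \<odot> \<one> \<ominus> a) \<le> K)"

text \<open>The triangle inequality absorbs the extra multiple of \<open>\<one>\<close>. This lets
  two elements with different witnesses share a common one.\<close>

lemma norm_positive_shift:
  assumes a: "a \<in> carrier A" and "nrm A (complex_of_real K \<odot> \<one> \<ominus> a) \<le> K" "K \<le> L"
  shows "nrm A (complex_of_real L \<odot> \<one> \<ominus> a) \<le> L"
proof -
  have "complex_of_real L \<odot> \<one> = complex_of_real (L - K) \<odot> \<one> \<oplus> complex_of_real K \<odot> \<one>"
    by (simp flip: add_smult of_real_add)
  then have "complex_of_real L \<odot> \<one> \<ominus> a =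
      complex_of_real (L - K) \<odot> \<one> \<oplus> (complex_of_real K \<odot> \<one> \<ominus> a)"
    using a by (simp add: A_ring)
  also have "nrm A \<dots> \<le> nrm A (complex_of_real (L - K) \<odot> \<one>) + nrm A (complex_of_real K \<odot> \<one> \<ominus> a)"
    using a by (intro nrm_triangle) (simp_all add: A_ring)
  also have "\<dots> \<le> (L - K) + K"
    using assms by (simp add: nrm_smult del: of_real_diff)
  finally show ?thesis by simp
qed

lemma norm_positive_zero: "norm_positive \<zero>"
  unfolding norm_positive_def by (intro conjI exI[of _ 0]) (simp_all add: A_ring)

lemma norm_positive_add:
  assumes "norm_positive a" "norm_positive b"
  shows "norm_positive (a \<oplus> b)"
proof -
  obtain K L where ab: "a \<in> carrier A" "b \<in> carrier A" "0 \<le> K" "0 \<le> L"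
    and K: "nrm A (complex_of_real K \<odot> \<one> \<ominus> a) \<le> K"
    and L: "nrm A (complex_of_real L \<odot> \<one> \<ominus> b) \<le> L"
    using assms unfolding norm_positive_def by blast
  have "complex_of_real (K + L) \<odot> \<one> \<ominus> (a \<oplus> b) =
      (complex_of_real K \<odot> \<one> \<ominus> a) \<oplus> (complex_of_real L \<odot> \<one> \<ominus> b)"
    using ab by (simp add: A_ring add_smult)
  then have "nrm A (complex_of_real (K + L) \<odot> \<one> \<ominus> (a \<oplus> b)) \<le> K + L"
    using nrm_triangle[of "complex_of_real K \<odot> \<one> \<ominus> a" "complex_of_real L \<odot> \<one> \<ominus> b"] K L ab
    by simp
  with ab show ?thesis
    unfolding norm_positive_def by (metis A_closed(1) add_nonneg_nonneg)
qed

lemma norm_positive_finsum: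
  assumes "finite I" "\<And>i. i \<in> I \<Longrightarrow> norm_positive (f i)"
  shows "norm_positive (\<Oplus>i\<in>I. f i)"
  using assms
proof (induction I rule: finite_induct)
  case (insert i I)
  moreover have "f j \<in> carrier A" if "j \<in> insert i I" for j
    using insert.prems[OF that] by (simp add: norm_positive_def)
  ultimately show ?case
    by (simp add: A_finsum_insert Pi_def norm_positive_add)
qed (simp add: A_finsum_empty norm_positive_zero)

text \<open>Dividing by a common witness \<open>M\<close> gives \<open>x\<close> with
  \<open>\<one> \<oplus> x\<close> and \<open>\<one> \<ominus> x\<close> of norm at most 1, the case
  settled by \<open>selfadjoint_eq_zero\<close>.\<close>

lemma norm_positive_antisym:
  assumes "norm_positive a" "norm_positive (\<ominus> a)" and sa: "adj A a = a"
  shows "a = \<zero>"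
proof -
  obtain K L where a: "a \<in> carrier A" and KL: "0 \<le> K" "0 \<le> L"
    and K: "nrm A (complex_of_real K \<odot> \<one> \<ominus> a) \<le> K"
    and L: "nrm A (complex_of_real L \<odot> \<one> \<ominus> (\<ominus> a)) \<le> L"
    using assms unfolding norm_positive_def by blast
  \<comment> \<open>The summand 1 keeps \<open>M\<close> invertible even if \<open>K\<close> and
    \<open>L\<close> are both 0.\<close>
  define M where "M = K + L + 1"
  have M: "0 < M" using KL by (simp add: M_def)
  define x where "x = complex_of_real (1 / M) \<odot> a"
  have x: "x \<in> carrier A" and sax: "adj A x = x"
    using a sa by (simp_all add: x_def adj_smult)
  have minus: "c \<odot> (\<ominus> b) = \<ominus> (c \<odot> b)" if "b \<in> carrier A" for c b
    using that by (simp add: smult_smult flip: minus_one_smult)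
  have scale: "nrm A (\<one> \<ominus> complex_of_real (1 / M) \<odot> b) \<le> 1"
    if b: "b \<in> carrier A" and "nrm A (complex_of_real M \<odot> \<one> \<ominus> b) \<le> M" for b
  proof -
    have "\<one> \<ominus> complex_of_real (1 / M) \<odot> b = complex_of_real (1 / M) \<odot> (complex_of_real M \<odot> \<one> \<ominus> b)"
      using b M by (simp add: A_ring smult_add smult_smult minus)
    then have "nrm A (\<one> \<ominus> complex_of_real (1 / M) \<odot> b) =
        1 / M * nrm A (complex_of_real M \<odot> \<one> \<ominus> b)"
      using b M nrm_smult[of "complex_of_real M \<odot> \<one> \<ominus> b" "complex_of_real (1 / M)"]
      by (simp add: norm_divide)
    with that(2) M show ?thesis by (simp add: divide_le_eq_1)
  qed
  have "nrm A (complex_of_real M \<odot> \<one> \<ominus> a) \<le> M" "nrm A (complex_of_real M \<odot> \<one> \<ominus> (\<ominus> a)) \<le> M"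
    using norm_positive_shift[OF a K, of M] norm_positive_shift[of "\<ominus> a" L M] a L KL
    by (simp_all add: M_def)
  from scale[OF a this(1)] scale[OF A_closed(3)[OF a] this(2)]
  have "nrm A (\<one> \<oplus> x) \<le> 1" "nrm A (\<one> \<ominus> x) \<le> 1"
    using a by (simp_all add: x_def minus A_ring)
  then have "x = \<zero>" by (rule selfadjoint_eq_zero[OF x sax])
  then have "complex_of_real M \<odot> x = \<zero>" by simp
  then show ?thesis using a M by (simp add: x_def smult_smult)
qed

text \<open>For the range projection \<open>p\<close> of \<open>w\<close>, the element
  \<open>u\<close>, which is 1 - 2\<open>p\<close>, is self-adjoint with square 1 and so has norm 1.
  Because \<open>adj A v \<otimes> v = \<one>\<close>, half its compression by \<open>v\<close> is
  1/2 minus the compression of \<open>p\<close>, so 1/2 serves as the witness.\<close>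

lemma norm_positive_compression:
  assumes v: "v \<in> isometries A" and w: "w \<in> isometries A"
  shows "norm_positive (adj A v \<otimes> (w \<otimes> adj A w) \<otimes> v)"
proof -
  define p where "p = w \<otimes> adj A w"
  define u where "u = \<one> \<oplus> (- 2) \<odot> p"
  have vA: "v \<in> carrier A" and vv: "adj A v \<otimes> v = \<one>"
    and wA: "w \<in> carrier A" and ww: "adj A w \<otimes> w = \<one>"
    using v w by (auto simp: isometries_def)
  have p: "p \<in> carrier A" "adj A p = p"
    using wA by (simp_all add: p_def adj_mult adj_adj)
  have "p \<otimes> p = w \<otimes> (adj A w \<otimes> w) \<otimes> adj A w"
    using wA by (simp add: p_def A_ring)
  then have pp: "p \<otimes> p = p"
    using wA by (simp add: ww p_def A_ring)
  have u: "u \<in> carrier A" "adj A u = u"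
    using p by (simp_all add: u_def A_ring adj_add adj_smult)
  have "u \<otimes> u = \<one> \<oplus> ((- 2) \<odot> p \<oplus> ((- 2) \<odot> p \<oplus> 4 \<odot> p))"
    using p by (simp add: u_def A_ring smult_mult_left smult_mult_right smult_smult pp smult_add)
  also have "\<dots> = \<one>"
    using p by (simp add: A_ring flip: add_smult)
  finally have "(nrm A u)\<^sup>2 = 1"
    using cstar_identity[of u] u by simp
  then have nu: "nrm A u = 1"
    using nrm_nonneg[OF u(1)] by (simp add: power2_eq_1_iff)
  have eq: "complex_of_real (1/2) \<odot> \<one> \<ominus> adj A v \<otimes> p \<otimes> v = (1/2) \<odot> (adj A v \<otimes> (u \<otimes> v))"
    using vA p by (simp add: u_def A_ring smult_mult_left smult_mult_right smult_smult smult_add vv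
        minus_one_smult)
  have "nrm A (adj A v \<otimes> (u \<otimes> v)) \<le> nrm A (adj A v) * nrm A (u \<otimes> v)"
    using vA u by (intro nrm_mult) simp_all
  also have "\<dots> \<le> 1 * (nrm A u * nrm A v)"
    using nrm_mult[OF u(1) vA] by (simp add: nrm_adj[OF vA] nrm_isometry[OF v])
  also have "\<dots> = 1"
    by (simp add: nu nrm_isometry[OF v])
  finally have "nrm A (complex_of_real (1/2) \<odot> \<one> \<ominus> adj A v \<otimes> p \<otimes> v) \<le> 1/2"
    unfolding eq using vA u by (simp add: nrm_smult)
  then show ?thesis
    using vA p unfolding norm_positive_def p_def[symmetric]
    by (intro conjI exI[of _ "1/2"]) simp_all
qed

section \<open>Isometries with range projections summing to the identity\<close>

text \<open>The Cuntz relations over a finite index set of any type. Orthogonality of the ranges is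
  derived in \<open>cuntz_row_orthogonal\<close>.\<close>

definition cuntz_row :: "'i set \<Rightarrow> ('i \<Rightarrow> 'a) \<Rightarrow> bool" where
  "cuntz_row I v \<longleftrightarrow>
     finite I \<and> (\<forall>i\<in>I. v i \<in> isometries A) \<and> (\<Oplus>i\<in>I. v i \<otimes> adj A (v i)) = \<one>"

lemma cuntz_rowD:
  assumes "cuntz_row I v"
  shows "finite I" "(\<Oplus>i\<in>I. v i \<otimes> adj A (v i)) = \<one>"
    and "i \<in> I \<Longrightarrow> v i \<in> carrier A" "i \<in> I \<Longrightarrow> adj A (v i) \<otimes> v i = \<one>"
  using assms by (auto simp: cuntz_row_def isometries_def)

lemma cuntz_row_orthogonal:
  assumes row: "cuntz_row I v" and i: "i \<in> I" and j: "j \<in> I" and "i \<noteq> j"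
  shows "adj A (v i) \<otimes> v j = \<zero>"
proof -
  note r = cuntz_rowD[OF row]
  \<comment> \<open>Compressing the sum of the range projections by \<open>v j\<close> gives \<open>1\<close>, and so does its \<open>j\<close>-th summand
    alone; the remaining summands are positive and sum to \<open>0\<close>.\<close>
  define b where "b = (\<lambda>k. adj A (v j) \<otimes> (v k \<otimes> adj A (v k)) \<otimes> v j)"
  have bA: "b k \<in> carrier A" if "k \<in> I" for k
    using r(3)[OF that] r(3)[OF j] by (simp add: b_def)
  have pos: "norm_positive (b k)" if "k \<in> I" for k
    using row that j unfolding b_def by (intro norm_positive_compression) (auto simp: cuntz_row_def)
  have "(\<Oplus>k\<in>I. b k) = adj A (v j) \<otimes> (\<Oplus>k\<in>I. v k \<otimes> adj A (v k)) \<otimes> v j"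
    unfolding b_def using r(1,3) j
    by (simp add: A_finsum_ldistr A_finsum_rdistr Pi_def)
  then have sum1: "(\<Oplus>k\<in>I. b k) = \<one>"
    using r(2) r(3)[OF j] r(4)[OF j] by (simp add: A_ring)
  have "adj A (v j) \<otimes> (v j \<otimes> adj A (v j)) \<otimes> v j = (adj A (v j) \<otimes> v j) \<otimes> (adj A (v j) \<otimes> v j)"
    using r(3)[OF j] by (simp add: A_ring)
  then have bj: "b j = \<one>" by (simp add: b_def r(4)[OF j] A_ring)
  define s where "s = (\<Oplus>k\<in>I - {i, j}. b k)"
  have sA: "s \<in> carrier A" unfolding s_def using bA by blast
  have "I = insert j (insert i (I - {i, j}))" using i j by blast
  then have "(\<Oplus>k\<in>I. b k) = (\<Oplus>k\<in>insert j (insert i (I - {i, j})). b k)" by simp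
  also have "\<dots> = b j \<oplus> (b i \<oplus> s)"
    unfolding s_def using r(1) bA i j \<open>i \<noteq> j\<close> by (simp add: A_finsum_insert Pi_def)
  finally have "\<one> \<oplus> (b i \<oplus> s) = \<one>" using sum1 bj by simp
  then have "b i \<oplus> s = \<ominus> \<one> \<oplus> \<one>"
    using A_neg_cancel[of "\<one>" "b i \<oplus> s"] bA[OF i] sA by simp
  then have "s \<oplus> b i = \<zero>" using bA[OF i] sA by (simp add: A_ring)
  \<comment> \<open>The negative of \<open>b i\<close> is a sum of positive elements, so
    antisymmetry of positivity applies to \<open>b i\<close>.\<close>
  then have "\<ominus> b i = s"
    using bA[OF i] sA by (intro abelian_group.minus_equality[OF ring.is_abelian_group[OF ring_A]])
  moreover have "norm_positive s"
    unfolding s_def using r(1) pos by (intro norm_positive_finsum) auto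
  moreover have "adj A (b i) = b i"
    using r(3)[OF i] r(3)[OF j] by (simp add: b_def adj_mult adj_adj A_ring)
  ultimately have "b i = \<zero>" using pos[OF i] by (intro norm_positive_antisym) simp_all
  \<comment> \<open>In this form the C*-identity passes from \<open>b i = \<zero>\<close> to the
    vanishing of \<open>adj A (v i) \<otimes> v j\<close>.\<close>
  moreover have "b i = adj A (adj A (v i) \<otimes> v j) \<otimes> (adj A (v i) \<otimes> v j)"
    using r(3)[OF i] r(3)[OF j] by (simp add: b_def adj_mult adj_adj A_ring)
  ultimately have "(nrm A (adj A (v i) \<otimes> v j))\<^sup>2 = 0"
    using cstar_identity[of "adj A (v i) \<otimes> v j"] r(3)[OF i] r(3)[OF j] nrm_eq_zero[of \<zero>]
    by simp
  then show ?thesis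
    using nrm_eq_zero[of "adj A (v i) \<otimes> v j"] r(3)[OF i] r(3)[OF j] by simp
qed

text \<open>Orthogonality removes every summand except the one at \<open>k\<close>. Thus an element
  with prescribed products against a row can be written down explicitly.\<close>

lemma cuntz_row_expand:
  assumes row: "cuntz_row I v" and x: "\<And>i. i \<in> I \<Longrightarrow> x i \<in> carrier A" and k: "k \<in> I"
  shows "(\<Oplus>i\<in>I. x i \<otimes> adj A (v i)) \<otimes> v k = x k"
proof -
  note r = cuntz_rowD[OF row]
  have "(\<Oplus>i\<in>I. x i \<otimes> adj A (v i)) \<otimes> v k = (\<Oplus>i\<in>I. x i \<otimes> adj A (v i) \<otimes> v k)"
    using r(1,3) x k by (intro A_finsum_ldistr) auto
  also have "\<dots> = (\<Oplus>i\<in>I. if k = i then x i else \<zero>)"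
  proof (rule A_finsum_cong')
    fix i assume i: "i \<in> I"
    have "x i \<otimes> adj A (v i) \<otimes> v k = x i \<otimes> (adj A (v i) \<otimes> v k)"
      using x[OF i] r(3)[OF i] r(3)[OF k] by (simp add: A_ring)
    then show "x i \<otimes> adj A (v i) \<otimes> v k = (if k = i then x i else \<zero>)"
      using r(4)[OF i] cuntz_row_orthogonal[OF row i k] x[OF i] by (auto simp: A_ring)
  qed (use x in \<open>auto\<close>)
  also have "\<dots> = x k"
    using r(1) x k by (intro A_finsum_singleton) auto
  finally show ?thesis .
qed

lemma cuntz_row_sum:
  assumes row: "cuntz_row I v" and a: "a \<in> carrier A"
  shows "(\<Oplus>i\<in>I. a \<otimes> v i \<otimes> adj A (v i)) = a"
proof -
  note r = cuntz_rowD[OF row]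
  have "a = a \<otimes> (\<Oplus>i\<in>I. v i \<otimes> adj A (v i))"
    using a r(2) by (simp add: A_ring)
  also have "\<dots> = (\<Oplus>i\<in>I. a \<otimes> (v i \<otimes> adj A (v i)))"
    using r(1,3) a by (intro A_finsum_rdistr) auto
  also have "\<dots> = (\<Oplus>i\<in>I. a \<otimes> v i \<otimes> adj A (v i))"
    using r(3) a by (intro A_finsum_cong') (auto simp: A_ring)
  finally show ?thesis by simp
qed

text \<open>Multiplying on the right by \<open>adj A (v i)\<close> and summing over \<open>i\<close>
  recovers \<open>a\<close> on one side and \<open>b\<close> on the other.\<close>

lemma cuntz_row_cancel:
  assumes row: "cuntz_row I v" and a: "a \<in> carrier A" and b: "b \<in> carrier A"
    and eq: "\<And>i. i \<in> I \<Longrightarrow> a \<otimes> v i = b \<otimes> v i"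
  shows "a = b"
proof -
  have "(\<Oplus>i\<in>I. a \<otimes> v i \<otimes> adj A (v i)) = (\<Oplus>i\<in>I. b \<otimes> v i \<otimes> adj A (v i))"
    using cuntz_rowD(3)[OF row] a b by (intro A_finsum_cong') (auto simp: eq)
  then show ?thesis by (simp add: cuntz_row_sum[OF row] a b)
qed

text \<open>The sum maps each \<open>v k\<close> to \<open>w k\<close> and its adjoint maps each
  \<open>w k\<close> back to \<open>v k\<close>. Both products of the two therefore fix a row, and
  \<open>cuntz_row_cancel\<close> identifies them with \<open>\<one>\<close>.\<close>

lemma cuntz_row_intertwiner_unitary:
  assumes v: "cuntz_row I v" and w: "cuntz_row I w"
  shows "(\<Oplus>i\<in>I. w i \<otimes> adj A (v i)) \<in> unitaries A"
proof -
  note rv = cuntz_rowD[OF v] and rw = cuntz_rowD[OF w]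
  define U where "U = (\<Oplus>i\<in>I. w i \<otimes> adj A (v i))"
  have UA: "U \<in> carrier A"
    unfolding U_def using rv(3) rw(3) by auto
  have adjU: "adj A U = (\<Oplus>i\<in>I. v i \<otimes> adj A (w i))"
    unfolding U_def using rv(1,3) rw(3)
    by (subst adj_finsum) (auto intro!: A_finsum_cong' simp: adj_mult adj_adj)
  have Uv: "U \<otimes> v k = w k" if "k \<in> I" for k
    unfolding U_def using cuntz_row_expand[OF v rw(3) that] by simp
  have Uw: "adj A U \<otimes> w k = v k" if "k \<in> I" for k
    unfolding adjU using cuntz_row_expand[OF w rv(3) that] by simp
  have "adj A U \<otimes> U = \<one>"
    by (rule cuntz_row_cancel[OF v]) (simp_all add: UA rv(3) Uv Uw A_assoc)
  moreover have "U \<otimes> adj A U = \<one>"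
    by (rule cuntz_row_cancel[OF w]) (simp_all add: UA rw(3) Uv Uw A_assoc)
  ultimately show ?thesis
    using UA by (simp add: unitaries_def U_def)
qed

lemma isometries_mult:
  assumes "v \<in> isometries A" "w \<in> isometries A"
  shows "v \<otimes> w \<in> isometries A"
proof -
  have vw: "v \<in> carrier A" "w \<in> carrier A" "adj A v \<otimes> v = \<one>" "adj A w \<otimes> w = \<one>"
    using assms by (auto simp: isometries_def)
  have "adj A (v \<otimes> w) \<otimes> (v \<otimes> w) = adj A w \<otimes> (adj A v \<otimes> v) \<otimes> w"
    using vw(1,2) by (simp add: adj_mult A_ring)
  with vw show ?thesis by (simp add: isometries_def)
qed

lemma cuntz_row_unitary_mult:
  assumes row: "cuntz_row I v" and U: "U \<in> unitaries A"
  shows "cuntz_row I (\<lambda>i. U \<otimes> v i)"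
proof -
  note r = cuntz_rowD[OF row]
  have UA: "U \<in> carrier A" and UU: "U \<otimes> adj A U = \<one>" and iso: "U \<in> isometries A"
    using U by (auto simp: unitaries_def isometries_def)
  have "(\<Oplus>i\<in>I. (U \<otimes> v i) \<otimes> adj A (U \<otimes> v i)) =
      (\<Oplus>i\<in>I. U \<otimes> v i \<otimes> adj A (v i) \<otimes> adj A U)"
    using UA r(3) by (intro A_finsum_cong') (auto simp: adj_mult A_ring)
  also have "\<dots> = (\<Oplus>i\<in>I. U \<otimes> v i \<otimes> adj A (v i)) \<otimes> adj A U"
    using UA r(1,3) by (intro A_finsum_ldistr[symmetric]) auto
  also have "\<dots> = \<one>"
    by (simp add: cuntz_row_sum[OF row UA] UU)
  finally show ?thesis
    using row isometries_mult[OF iso] by (simp add: cuntz_row_def)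
qed

section \<open>Rows under endomorphisms\<close>

lemma End_finsum:
  assumes \<phi>: "\<phi> \<in> End_alg A" and "finite I" "\<And>i. i \<in> I \<Longrightarrow> f i \<in> carrier A"
  shows "\<phi> (\<Oplus>i\<in>I. f i) = (\<Oplus>i\<in>I. \<phi> (f i))"
  using assms(2,3)
proof (induction I rule: finite_induct)
  case empty
  \<comment> \<open>The definition of \<open>ring_hom\<close> speaks of sums, products and
    \<open>\<one>\<close>; zero is reached as a scalar multiple of \<open>\<one>\<close>.\<close>
  have "\<phi> (0 \<odot> \<one>) = 0 \<odot> \<phi> \<one>"
    by (rule star_homD[OF \<phi> A_closed(6)])
  then show ?case
    using star_homD(5)[OF \<phi> A_closed(6)] by (simp add: A_finsum_empty)
next
  case (insert i I)
  then show ?case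
    by (simp add: A_finsum_insert Pi_def star_homD[OF \<phi>])
qed

lemma End_cuntz_row:
  assumes \<phi>: "\<phi> \<in> End_alg A" and row: "cuntz_row I v"
  shows "cuntz_row I (\<lambda>i. \<phi> (v i))"
proof -
  note r = cuntz_rowD[OF row]
  have [simp]: "\<phi> \<one> = \<one>"
    by (rule star_homD(5)[OF \<phi> A_closed(6)])
  have "(\<Oplus>i\<in>I. \<phi> (v i) \<otimes> adj A (\<phi> (v i))) = (\<Oplus>i\<in>I. \<phi> (v i \<otimes> adj A (v i)))"
    using r(3) by (intro A_finsum_cong') (auto simp: star_homD[OF \<phi>])
  also have "\<dots> = \<phi> (\<Oplus>i\<in>I. v i \<otimes> adj A (v i))"
    using r(1,3) by (intro End_finsum[OF \<phi>, symmetric]) auto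
  finally have "(\<Oplus>i\<in>I. \<phi> (v i) \<otimes> adj A (\<phi> (v i))) = \<one>"
    by (simp add: r(2))
  moreover have "\<phi> (v i) \<in> isometries A" if "i \<in> I" for i
    using r(3,4)[OF that] star_homD(2)[OF \<phi>, of "adj A (v i)" "v i"]
    by (simp add: isometries_def star_homD[OF \<phi>])
  ultimately show ?thesis
    using r(1) by (simp add: cuntz_row_def)
qed

end

section \<open>Families indexed by the semigroup\<close>

lemma words_gens:
  "[] \<in> words m n" "i \<in> {1..m} \<Longrightarrow> [E i] \<in> words m n" "j \<in> {1..n} \<Longrightarrow> [F j] \<in> words m n"
  by (auto simp: words_def)

lemma tg_class_eq_of_step:
  assumes "tg_step m n \<theta> x y" "x \<in> words m n" "y \<in> words m n"
  shows "tg_class m n \<theta> x = tg_class m n \<theta> y"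
  using assms by (intro equiv_class_eq[OF equiv_tg_rel]) (auto simp: tg_rel_def)

lemma permutes_grid:
  fixes i j m n :: nat
  assumes "\<theta> permutes ({1..m} \<times> {1..n})" "i \<in> {1..m}" "j \<in> {1..n}" "\<theta> (i, j) = (i', j')"
  shows "i' \<in> {1..m}" "j' \<in> {1..n}"
  using permutes_in_image[OF assms(1), of "(i, j)"] assms(2-4) by auto

context cstar_algebra
begin

definition word_prod :: "(gen \<Rightarrow> 'a) \<Rightarrow> gen list \<Rightarrow> 'a" where
  "word_prod g w = foldr (\<lambda>x y. g x \<otimes> y) w \<one>"

lemma word_prod_simps [simp]:
  "word_prod g [] = \<one>" "word_prod g (x # w) = g x \<otimes> word_prod g w"
  by (simp_all add: word_prod_def)

lemma isometries_one: "\<one> \<in> isometries A"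
  by (simp add: isometries_def A_ring)

lemma word_prod_isometry:
  assumes "\<And>x. g x \<in> isometries A"
  shows "word_prod g w \<in> isometries A"
  using assms by (induction w) (simp_all add: isometries_one isometries_mult)

lemma word_prod_append:
  assumes "\<And>x. g x \<in> isometries A"
  shows "word_prod g (x @ y) = word_prod g x \<otimes> word_prod g y"
proof (induction x)
  case (Cons a x)
  have "g a \<in> carrier A" "word_prod g w \<in> carrier A" for w
    using assms word_prod_isometry[of g] by (auto simp: isometries_def)
  with Cons show ?case by (simp add: A_assoc)
qed (use word_prod_isometry[of g y] assms in \<open>auto simp: isometries_def\<close>)

text \<open>A rewriting step changes two adjacent letters, and the product over a word is
  multiplicative under concatenation. Hence the product descends to the quotient semigroup.\<close>

lemma word_prod_equiv:
  assumes g: "\<And>x. g x \<in> isometries A"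
    and comm: "\<And>i j i' j'. \<lbrakk>i \<in> {1..m}; j \<in> {1..n}; \<theta> (i, j) = (i', j')\<rbrakk> \<Longrightarrow>
      g (E i) \<otimes> g (F j) = g (F j') \<otimes> g (E i')"
    and "equivclp (tg_step m n \<theta>) x y"
  shows "word_prod g x = word_prod g y"
proof -
  have step: "word_prod g x = word_prod g y" if "tg_step m n \<theta> x y" for x y
    using that
  proof cases
    case (1 i j i' j' u v)
    have cl: "g z \<in> carrier A" "word_prod g w \<in> carrier A" for z w
      using g word_prod_isometry[of g] by (auto simp: isometries_def)
    have "word_prod g [E i, F j] = word_prod g [F j', E i']"
      using comm[OF 1(3-5)] by (simp add: cl)
    then show ?thesis
      unfolding 1(1,2) word_prod_append[of g, OF g] by simp
  qed
  from assms(3) show ?thesis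
    by (induction rule: equivclp_induct) (auto dest: step)
qed

text \<open>The semigroup is presented by the commutation relations alone, so products over words
  define a family on it. This supplies the family to which the universal property is
  applied.\<close>

lemma cuntz_family_of_generators:
  assumes row_e: "cuntz_row {1..m} (\<lambda>i. g (E i))" and row_f: "cuntz_row {1..n} (\<lambda>j. g (F j))"
    and comm: "\<And>i j i' j'. \<lbrakk>i \<in> {1..m}; j \<in> {1..n}; \<theta> (i, j) = (i', j')\<rbrakk> \<Longrightarrow>
      g (E i) \<otimes> g (F j) = g (F j') \<otimes> g (E i')"
    and \<theta>: "\<theta> permutes ({1..m} \<times> {1..n})"
  shows "\<exists>t. cuntz_family m n \<theta> A t \<and>
    (\<forall>i\<in>{1..m}. t (gen_e m n \<theta> i) = g (E i)) \<and> (\<forall>j\<in>{1..n}. t (gen_f m n \<theta> j) = g (F j))"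
proof -
  \<comment> \<open>The lemmas on \<open>word_prod\<close> ask for an isometry at every letter, so
    letters outside the alphabet are sent to \<open>\<one>\<close>.\<close>
  define h where "h x = (if [x] \<in> words m n then g x else \<one>)" for x
  have words1: "[x] \<in> words m n \<longleftrightarrow> x \<in> E ` {1..m} \<union> F ` {1..n}" for x
    by (auto simp: words_def)
  have hE: "h (E i) = g (E i)" if "i \<in> {1..m}" for i
    using words_gens(2)[OF that] by (simp add: h_def)
  have hF: "h (F j) = g (F j)" if "j \<in> {1..n}" for j
    using words_gens(3)[OF that] by (simp add: h_def)
  have h: "h x \<in> isometries A" for x
    using row_e row_f isometries_one by (auto simp: h_def words1 cuntz_row_def)
  \<comment> \<open>Since \<theta> maps the grid to itself, \<open>i'\<close> and \<open>j'\<close>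
    are in range and \<open>h\<close> agrees with \<open>g\<close> on all four letters.\<close>
  have hcomm: "h (E i) \<otimes> h (F j) = h (F j') \<otimes> h (E i')"
    if "i \<in> {1..m}" "j \<in> {1..n}" "\<theta> (i, j) = (i', j')" for i j i' j'
    using comm[OF that] that permutes_grid[OF \<theta> that] by (simp only: hE hF)
  \<comment> \<open>The chosen representative does not affect the value, by
    \<open>word_prod_equiv\<close>.\<close>
  define t where "t u = word_prod h (SOME w. w \<in> u)" for u
  have t: "t (tg_class m n \<theta> w) = word_prod h w" if "w \<in> words m n" for w
  proof -
    have rel: "equivclp (tg_step m n \<theta>) w w'" if "w' \<in> tg_class m n \<theta> w" for w'
      using that by (simp add: tg_rel_def)
    have "equivclp (tg_step m n \<theta>) w (SOME w'. w' \<in> tg_class m n \<theta> w)"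
      by (rule rel, rule someI, rule equiv_class_self[OF equiv_tg_rel that])
    from h hcomm this have "word_prod h w = word_prod h (SOME w'. w' \<in> tg_class m n \<theta> w)"
      by (rule word_prod_equiv)
    then show ?thesis
      by (simp only: t_def)
  qed
  have hcl: "h x \<in> carrier A" for x
    using h[of x] by (auto simp: isometries_def)
  have te: "t (gen_e m n \<theta> i) = g (E i)" if "i \<in> {1..m}" for i
    using hcl[of "E i"] by (simp add: t[OF words_gens(2)[OF that]] hE[OF that])
  have tf: "t (gen_f m n \<theta> j) = g (F j)" if "j \<in> {1..n}" for j
    using hcl[of "F j"] by (simp add: t[OF words_gens(3)[OF that]] hF[OF that])
  have "cuntz_family m n \<theta> A t"
    unfolding cuntz_family_def
  proof (intro conjI ballI)
    fix u assume "u \<in> carrier (two_graph m n \<theta>)"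
    then obtain x where x: "x \<in> words m n" "u = tg_class m n \<theta> x"
      by (auto simp: carrier_two_graph)
    then show "t u \<in> isometries A"
      using word_prod_isometry[of h, OF h] by (simp add: t)
    fix v assume "v \<in> carrier (two_graph m n \<theta>)"
    then obtain y where y: "y \<in> words m n" "v = tg_class m n \<theta> y"
      by (auto simp: carrier_two_graph)
    show "t (u \<otimes>\<^bsub>two_graph m n \<theta>\<^esub> v) = t u \<otimes> t v"
      unfolding x(2) y(2) tg_class_mult[OF x(1) y(1)] t[OF x(1)] t[OF y(1)]
        t[OF words_append[OF x(1) y(1)]] by (rule word_prod_append[of h, OF h])
  next
    show "t \<one>\<^bsub>two_graph m n \<theta>\<^esub> = \<one>"
      using t[OF words_gens(1)] by (simp add: two_graph_def)
  next
    have "(\<Oplus>i\<in>{1..m}. t (gen_e m n \<theta> i) \<otimes> adj A (t (gen_e m n \<theta> i))) =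
        (\<Oplus>i\<in>{1..m}. g (E i) \<otimes> adj A (g (E i)))"
      by (rule A_finsum_cong') (use cuntz_rowD(3)[OF row_e] in \<open>auto simp: te\<close>)
    then show "(\<Oplus>i\<in>{1..m}. t (gen_e m n \<theta> i) \<otimes> adj A (t (gen_e m n \<theta> i))) = \<one>"
      by (rule trans[OF _ cuntz_rowD(2)[OF row_e]])
  next
    have "(\<Oplus>j\<in>{1..n}. t (gen_f m n \<theta> j) \<otimes> adj A (t (gen_f m n \<theta> j))) =
        (\<Oplus>j\<in>{1..n}. g (F j) \<otimes> adj A (g (F j)))"
      by (rule A_finsum_cong') (use cuntz_rowD(3)[OF row_f] in \<open>auto simp: tf\<close>)
    then show "(\<Oplus>j\<in>{1..n}. t (gen_f m n \<theta> j) \<otimes> adj A (t (gen_f m n \<theta> j))) = \<one>"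
      by (rule trans[OF _ cuntz_rowD(2)[OF row_f]])
  qed
  with te tf show ?thesis by blast
qed

section \<open>Cuntz families determined by their generators\<close>

lemma gen_in_two_graph:
  "i \<in> {1..m} \<Longrightarrow> gen_e m n \<theta> i \<in> carrier (two_graph m n \<theta>)"
  "j \<in> {1..n} \<Longrightarrow> gen_f m n \<theta> j \<in> carrier (two_graph m n \<theta>)"
  unfolding carrier_two_graph by (intro imageI words_gens; assumption)+

lemma cuntz_family_rows:
  assumes "cuntz_family m n \<theta> A s"
  shows "cuntz_row {1..m} (\<lambda>i. s (gen_e m n \<theta> i))" "cuntz_row {1..n} (\<lambda>j. s (gen_f m n \<theta> j))"
  using assms gen_in_two_graph[where m = m and n = n and \<theta> = \<theta>]
  unfolding cuntz_family_def cuntz_row_def by blast+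

lemma cuntz_family_append:
  assumes "cuntz_family m n \<theta> A s" "x \<in> words m n" "y \<in> words m n"
  shows "s (tg_class m n \<theta> (x @ y)) = s (tg_class m n \<theta> x) \<otimes> s (tg_class m n \<theta> y)"
proof -
  have "tg_class m n \<theta> x \<in> carrier (two_graph m n \<theta>)" "tg_class m n \<theta> y \<in> carrier (two_graph m n \<theta>)"
    unfolding carrier_two_graph using assms(2,3) by blast+
  then show ?thesis
    using assms(1) unfolding cuntz_family_def tg_class_mult[OF assms(2,3), symmetric] by blast
qed

lemma cuntz_family_commute:
  assumes s: "cuntz_family m n \<theta> A s" and \<theta>: "\<theta> permutes ({1..m} \<times> {1..n})"
    and ij: "i \<in> {1..m}" "j \<in> {1..n}" "\<theta> (i, j) = (i', j')"
  shows "s (gen_e m n \<theta> i) \<otimes> s (gen_f m n \<theta> j) = s (gen_f m n \<theta> j') \<otimes> s (gen_e m n \<theta> i')"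
proof -
  note ij' = permutes_grid[OF \<theta> ij]
  note w = words_gens(2)[OF ij(1)] words_gens(3)[OF ij(2)] words_gens(3)[OF ij'(2)] words_gens(2)[OF ij'(1)]
  have "tg_class m n \<theta> ([E i] @ [F j]) = tg_class m n \<theta> ([F j'] @ [E i'])"
    using tg_step.intros[of i m j n \<theta> i' j' "[]" "[]"] ij
    by (intro tg_class_eq_of_step words_append w) simp
  then show ?thesis
    by (metis cuntz_family_append[OF s w(1,2)] cuntz_family_append[OF s w(3,4)])
qed

text \<open>Induction on a representing word, since both sides are multiplicative. It links the
  description of an endomorphism on generators with the universal property, which speaks of the
  whole semigroup.\<close>

lemma End_agree_on_generators:
  assumes s: "cuntz_family m n \<theta> A s" and t: "cuntz_family m n \<theta> A t" and \<phi>: "\<phi> \<in> End_alg A"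
    and e: "\<And>i. i \<in> {1..m} \<Longrightarrow> \<phi> (s (gen_e m n \<theta> i)) = t (gen_e m n \<theta> i)"
    and f: "\<And>j. j \<in> {1..n} \<Longrightarrow> \<phi> (s (gen_f m n \<theta> j)) = t (gen_f m n \<theta> j)"
    and u: "u \<in> carrier (two_graph m n \<theta>)"
  shows "\<phi> (s u) = t u"
proof -
  have cl: "s (tg_class m n \<theta> w) \<in> carrier A" if "w \<in> words m n" for w
    using s that by (auto simp: cuntz_family_def carrier_two_graph isometries_def)
  have "\<phi> (s (tg_class m n \<theta> w)) = t (tg_class m n \<theta> w)" if "w \<in> words m n" for w
    using that
  proof (induction w)
    case Nil
    have "s (tg_class m n \<theta> []) = \<one>" "t (tg_class m n \<theta> []) = \<one>"
      using s t by (simp_all add: cuntz_family_def two_graph_def)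
    then show ?case
      using star_homD(5)[OF \<phi> A_closed(6)] by simp
  next
    case (Cons x w)
    then have x: "[x] \<in> words m n" and w: "w \<in> words m n"
      by (auto simp: words_def)
    have "\<phi> (s (tg_class m n \<theta> [x])) = t (tg_class m n \<theta> [x])"
      using x e f by (auto simp: words_def)
    then show ?case
      using Cons.IH[OF w] cuntz_family_append[OF s x w] cuntz_family_append[OF t x w]
        star_homD(2)[OF \<phi> cl[OF x] cl[OF w]] by simp
  qed
  with u show ?thesis by (auto simp: carrier_two_graph)
qed

end

section \<open>Twisted pairs of unitaries\<close>

locale two_graph_algebra = cstar_algebra A for A :: "'a cstar" (structure) +
  fixes m n :: nat and \<theta> :: "nat \<times> nat \<Rightarrow> nat \<times> nat" and s :: "gen list set \<Rightarrow> 'a"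
  assumes perm: "\<theta> permutes ({1..m} \<times> {1..n})" and graph: "graph_cstar m n \<theta> A s"
begin

abbreviation se :: "nat \<Rightarrow> 'a" where "se i \<equiv> s (gen_e m n \<theta> i)"
abbreviation sf :: "nat \<Rightarrow> 'a" where "sf j \<equiv> s (gen_f m n \<theta> j)"

lemma family: "cuntz_family m n \<theta> A s"
  using graph by (simp add: graph_cstar_def)

lemmas row_e = cuntz_family_rows(1)[OF family]
lemmas row_f = cuntz_family_rows(2)[OF family]
lemmas se_closed [simp] = cuntz_rowD(3)[OF row_e]
lemmas sf_closed [simp] = cuntz_rowD(3)[OF row_f]
lemmas se_sf = cuntz_family_commute[OF family perm]

lemma lambda_closed [simp]:
  assumes "x \<in> carrier A"
  shows "lambda_e1 m n \<theta> A s x \<in> carrier A" "lambda_e2 m n \<theta> A s x \<in> carrier A"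
  unfolding lambda_e1_def lambda_e2_def using assms by auto

text \<open>These are instances of \<open>cuntz_row_expand\<close>, with
  \<open>se i \<otimes> x\<close> and \<open>sf j \<otimes> x\<close> as the coefficients of the
  rows.\<close>

lemma lambda_intertwines:
  assumes "x \<in> carrier A"
  shows "i \<in> {1..m} \<Longrightarrow> lambda_e1 m n \<theta> A s x \<otimes> se i = se i \<otimes> x"
    and "j \<in> {1..n} \<Longrightarrow> lambda_e2 m n \<theta> A s x \<otimes> sf j = sf j \<otimes> x"
  unfolding lambda_e1_def lambda_e2_def
  using cuntz_row_expand[OF row_e, of "\<lambda>i. se i \<otimes> x" i]
    cuntz_row_expand[OF row_f, of "\<lambda>j. sf j \<otimes> x" j] assms by auto

text \<open>Multiplying the twisted equation by \<open>se i \<otimes> sf j\<close> turns it into the commutation relations, and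
  nothing is lost because the ranges of these isometries sum to the identity.\<close>

lemma twisted_iff:
  assumes U: "U \<in> carrier A" and V: "V \<in> carrier A"
  shows "U \<otimes> lambda_e1 m n \<theta> A s V = V \<otimes> lambda_e2 m n \<theta> A s U \<longleftrightarrow>
    (\<forall>i\<in>{1..m}. \<forall>j\<in>{1..n}. \<forall>i' j'. \<theta> (i, j) = (i', j') \<longrightarrow>
      (U \<otimes> se i) \<otimes> (V \<otimes> sf j) = (V \<otimes> sf j') \<otimes> (U \<otimes> se i'))" (is "?L = ?R \<longleftrightarrow> ?comm")
proof -
  have L: "?L \<otimes> se i \<otimes> sf j = (U \<otimes> se i) \<otimes> (V \<otimes> sf j)" if "i \<in> {1..m}" "j \<in> {1..n}" for i j
  proof -
    have "?L \<otimes> se i \<otimes> sf j = U \<otimes> (lambda_e1 m n \<theta> A s V \<otimes> se i) \<otimes> sf j"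
      using that U V by (simp add: A_assoc)
    also have "\<dots> = (U \<otimes> se i) \<otimes> (V \<otimes> sf j)"
      unfolding lambda_intertwines(1)[OF V that(1)] using that U V by (simp add: A_assoc)
    finally show ?thesis .
  qed
  have R: "?R \<otimes> se i \<otimes> sf j = (V \<otimes> sf j') \<otimes> (U \<otimes> se i')"
    if ij: "i \<in> {1..m}" "j \<in> {1..n}" "\<theta> (i, j) = (i', j')" for i j i' j'
  proof -
    note ij' = permutes_grid[OF perm ij]
    \<comment> \<open>The factors are regrouped so that \<open>se_sf\<close> can bring an
      \<open>sf\<close> to the front, next to \<open>lambda_e2\<close>.\<close>
    have "?R \<otimes> se i \<otimes> sf j = ?R \<otimes> (se i \<otimes> sf j)"
      using ij U V by (simp add: A_assoc)
    also have "\<dots> = V \<otimes> (lambda_e2 m n \<theta> A s U \<otimes> sf j') \<otimes> se i'"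
      unfolding se_sf[OF ij] using ij' U V by (simp add: A_assoc)
    also have "\<dots> = (V \<otimes> sf j') \<otimes> (U \<otimes> se i')"
      unfolding lambda_intertwines(2)[OF U ij'(2)] using ij' U V by (simp add: A_assoc)
    finally show ?thesis .
  qed
  show ?thesis
  proof
    assume "?L = ?R"
    then show ?comm using L R by metis
  next
    assume comm: ?comm
    \<comment> \<open>Cancellation in two stages: the row of the \<open>sf j\<close> for fixed
      \<open>i\<close>, then the row of the \<open>se i\<close>.\<close>
    have "?L \<otimes> se i = ?R \<otimes> se i" if i: "i \<in> {1..m}" for i
    proof (rule cuntz_row_cancel[OF row_f])
      fix j assume j: "j \<in> {1..n}"
      obtain i' j' where ij: "\<theta> (i, j) = (i', j')" by (cases "\<theta> (i, j)")
      show "?L \<otimes> se i \<otimes> sf j = ?R \<otimes> se i \<otimes> sf j"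
        using comm i j ij by (simp add: L[OF i j] R[OF i j ij])
    qed (use i U V in simp_all)
    then show "?L = ?R"
      by (rule cuntz_row_cancel[OF row_e, rotated 2]) (simp_all add: U V)
  qed
qed

text \<open>Unitaries carry rows to rows and \<open>twisted_iff\<close> supplies the commutation
  relations, so \<open>U \<otimes> se i\<close> and \<open>V \<otimes> sf j\<close> extend to a
  Cuntz family \<open>t\<close> in \<open>A\<close>. The universal property with target
  \<open>A\<close> then gives existence and uniqueness together.\<close>

lemma lambda_UV_exists_unique:
  assumes UV: "(U, V) \<in> U2_twi m n \<theta> A s"
  shows "\<exists>!\<phi>. is_lambda_UV m n \<theta> A s U V \<phi>"
proof -
  have U: "U \<in> unitaries A" and V: "V \<in> unitaries A" and
    tw: "U \<otimes> lambda_e1 m n \<theta> A s V = V \<otimes> lambda_e2 m n \<theta> A s U"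
    using UV by (auto simp: U2_twi_def)
  have cl: "U \<in> carrier A" "V \<in> carrier A"
    using U V by (auto simp: unitaries_def)
  define g where "g = case_gen (\<lambda>i. U \<otimes> se i) (\<lambda>j. V \<otimes> sf j)"
  have g: "g (E i) = U \<otimes> se i" "g (F j) = V \<otimes> sf j" for i j
    by (simp_all add: g_def)
  obtain t where t: "cuntz_family m n \<theta> A t"
    and te: "\<And>i. i \<in> {1..m} \<Longrightarrow> t (gen_e m n \<theta> i) = U \<otimes> se i"
    and tf: "\<And>j. j \<in> {1..n} \<Longrightarrow> t (gen_f m n \<theta> j) = V \<otimes> sf j"
    using cuntz_family_of_generators[of m g n \<theta>, unfolded g, OF cuntz_row_unitary_mult[OF row_e U]
        cuntz_row_unitary_mult[OF row_f V] _ perm] twisted_iff[OF cl] tw by blast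
  have "is_lambda_UV m n \<theta> A s U V \<phi> \<longleftrightarrow>
      \<phi> \<in> End_alg A \<and> (\<forall>u\<in>carrier (two_graph m n \<theta>). \<phi> (s u) = t u)" (is "_ \<longleftrightarrow> ?Q \<phi>") for \<phi>
  proof
    assume "is_lambda_UV m n \<theta> A s U V \<phi>"
    then show "?Q \<phi>"
      using End_agree_on_generators[OF family t, of \<phi>] te tf by (simp add: is_lambda_UV_def)
  next
    assume "?Q \<phi>"
    then show "is_lambda_UV m n \<theta> A s U V \<phi>"
      using gen_in_two_graph[where m = m and n = n and \<theta> = \<theta>] te tf by (simp add: is_lambda_UV_def)
  qed
  moreover have "\<exists>!\<phi>. ?Q \<phi>"
    using graph t by (simp add: graph_cstar_def)
  ultimately show ?thesis by simp
qed

section \<open>The inverse map and bijectivity\<close>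

definition inv_Psi :: "('a \<Rightarrow> 'a) \<Rightarrow> 'a \<times> 'a" where
  "inv_Psi \<phi> = (\<Oplus>i\<in>{1..m}. \<phi> (se i) \<otimes> adj A (se i), \<Oplus>j\<in>{1..n}. \<phi> (sf j) \<otimes> adj A (sf j))"

text \<open>An endomorphism carries the two rows to rows, so both components are unitary
  intertwiners. Applying \<phi> to the commutation relations of the generators yields those required
  by \<open>twisted_iff\<close>.\<close>

lemma inv_Psi_twisted:
  assumes \<phi>: "\<phi> \<in> End_alg A" and UV: "inv_Psi \<phi> = (U, V)"
  shows "(U, V) \<in> U2_twi m n \<theta> A s" "is_lambda_UV m n \<theta> A s U V \<phi>"
proof -
  have eq: "U = (\<Oplus>i\<in>{1..m}. \<phi> (se i) \<otimes> adj A (se i))" "V = (\<Oplus>j\<in>{1..n}. \<phi> (sf j) \<otimes> adj A (sf j))"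
    using UV by (simp_all add: inv_Psi_def)
  have uni: "U \<in> unitaries A" "V \<in> unitaries A"
    unfolding eq using row_e row_f End_cuntz_row[OF \<phi>] by (intro cuntz_row_intertwiner_unitary; blast)+
  then have cl: "U \<in> carrier A" "V \<in> carrier A"
    by (auto simp: unitaries_def)
  have Ue: "U \<otimes> se i = \<phi> (se i)" if "i \<in> {1..m}" for i
    unfolding eq using cuntz_row_expand[OF row_e _ that, of "\<lambda>i. \<phi> (se i)"] star_homD(1)[OF \<phi>] by simp
  have Vf: "V \<otimes> sf j = \<phi> (sf j)" if "j \<in> {1..n}" for j
    unfolding eq using cuntz_row_expand[OF row_f _ that, of "\<lambda>j. \<phi> (sf j)"] star_homD(1)[OF \<phi>] by simp
  show "is_lambda_UV m n \<theta> A s U V \<phi>"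
    using \<phi> Ue Vf by (simp add: is_lambda_UV_def)
  have "(U \<otimes> se i) \<otimes> (V \<otimes> sf j) = (V \<otimes> sf j') \<otimes> (U \<otimes> se i')"
    if ij: "i \<in> {1..m}" "j \<in> {1..n}" "\<theta> (i, j) = (i', j')" for i j i' j'
  proof -
    note ij' = permutes_grid[OF perm ij]
    have "\<phi> (se i) \<otimes> \<phi> (sf j) = \<phi> (sf j') \<otimes> \<phi> (se i')"
      using star_homD(2)[OF \<phi>, of "se i" "sf j"] star_homD(2)[OF \<phi>, of "sf j'" "se i'"]
        se_sf[OF ij] ij ij' by simp
    then show ?thesis using ij ij' by (simp only: Ue Vf)
  qed
  then show "(U, V) \<in> U2_twi m n \<theta> A s"
    using uni twisted_iff[OF cl] by (simp add: U2_twi_def)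
qed

text \<open>Substituting the values of \<phi> on generators leaves \<open>U\<close> and
  \<open>V\<close> times a sum of range projections equal to \<open>\<one>\<close>. This makes
  \<open>Psi\<close> injective.\<close>

lemma inv_Psi_unique:
  assumes "is_lambda_UV m n \<theta> A s U V \<phi>" and cl: "U \<in> carrier A" "V \<in> carrier A"
  shows "inv_Psi \<phi> = (U, V)"
proof -
  have "\<phi> (se i) = U \<otimes> se i" if "i \<in> {1..m}" for i
    using assms that by (simp add: is_lambda_UV_def)
  then have "(\<Oplus>i\<in>{1..m}. \<phi> (se i) \<otimes> adj A (se i)) = (\<Oplus>i\<in>{1..m}. U \<otimes> se i \<otimes> adj A (se i))"
    using cl by (intro A_finsum_cong') auto
  moreover have "\<phi> (sf j) = V \<otimes> sf j" if "j \<in> {1..n}" for j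
    using assms that by (simp add: is_lambda_UV_def)
  then have "(\<Oplus>j\<in>{1..n}. \<phi> (sf j) \<otimes> adj A (sf j)) = (\<Oplus>j\<in>{1..n}. V \<otimes> sf j \<otimes> adj A (sf j))"
    using cl by (intro A_finsum_cong') auto
  ultimately show ?thesis
    using cuntz_row_sum[OF row_e cl(1)] cuntz_row_sum[OF row_f cl(2)] by (simp add: inv_Psi_def)
qed

lemma is_lambda_UV_Psi:
  assumes "(U, V) \<in> U2_twi m n \<theta> A s"
  shows "is_lambda_UV m n \<theta> A s U V (Psi m n \<theta> A s (U, V))"
  unfolding Psi_def using theI'[OF lambda_UV_exists_unique[OF assms]] by simp

lemma inv_Psi_Psi:
  assumes "p \<in> U2_twi m n \<theta> A s"
  shows "inv_Psi (Psi m n \<theta> A s p) = p"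
  using assms is_lambda_UV_Psi[of "fst p" "snd p"] inv_Psi_unique[of "fst p" "snd p"]
  by (auto simp: U2_twi_def unitaries_def)

lemma Psi_inv_Psi:
  assumes "\<phi> \<in> End_alg A"
  shows "inv_Psi \<phi> \<in> U2_twi m n \<theta> A s" "Psi m n \<theta> A s (inv_Psi \<phi>) = \<phi>"
proof -
  obtain U V where UV: "inv_Psi \<phi> = (U, V)" by (cases "inv_Psi \<phi>")
  note tw = inv_Psi_twisted[OF assms UV]
  show "inv_Psi \<phi> \<in> U2_twi m n \<theta> A s" using tw(1) UV by simp
  show "Psi m n \<theta> A s (inv_Psi \<phi>) = \<phi>"
    using lambda_UV_exists_unique[OF tw(1)] is_lambda_UV_Psi[OF tw(1)] tw(2) UV by auto
qed

lemma bij_betw_Psi: "bij_betw (Psi m n \<theta> A s) (U2_twi m n \<theta> A s) (End_alg A)"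
proof (rule bij_betw_byWitness[where f' = inv_Psi])
  show "Psi m n \<theta> A s ` U2_twi m n \<theta> A s \<subseteq> End_alg A"
    using is_lambda_UV_Psi by (auto simp: is_lambda_UV_def)
qed (use inv_Psi_Psi Psi_inv_Psi in auto)

end

theorem theorem3p2:
  fixes m n :: nat and \<theta> :: "nat \<times> nat \<Rightarrow> nat \<times> nat"
    and A :: "'a cstar" and s :: "gen list set \<Rightarrow> 'a"
  assumes "\<theta> permutes ({1..m} \<times> {1..n})"
    and "graph_cstar m n \<theta> A s"
  shows "(\<forall>(U, V)\<in>U2_twi m n \<theta> A s. \<exists>!\<phi>. is_lambda_UV m n \<theta> A s U V \<phi>) \<and>
    bij_betw (Psi m n \<theta> A s) (U2_twi m n \<theta> A s) (End_alg A) \<and>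
    (\<forall>\<phi>\<in>End_alg A. the_inv_into (U2_twi m n \<theta> A s) (Psi m n \<theta> A s) \<phi> =
      (\<Oplus>\<^bsub>A\<^esub>i\<in>{1..m}. \<phi> (s (gen_e m n \<theta> i)) \<otimes>\<^bsub>A\<^esub> adj A (s (gen_e m n \<theta> i)),
       \<Oplus>\<^bsub>A\<^esub>j\<in>{1..n}. \<phi> (s (gen_f m n \<theta> j)) \<otimes>\<^bsub>A\<^esub> adj A (s (gen_f m n \<theta> j))))"
proof -
  interpret two_graph_algebra A m n \<theta> s
    using assms by (auto simp: two_graph_algebra_def two_graph_algebra_axioms_def graph_cstar_def)
  have "the_inv_into (U2_twi m n \<theta> A s) (Psi m n \<theta> A s) \<phi> = inv_Psi \<phi>" if "\<phi> \<in> End_alg A" for \<phi>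
    by (rule the_inv_into_f_eq[OF bij_betw_imp_inj_on[OF bij_betw_Psi] Psi_inv_Psi(2)[OF that]
          Psi_inv_Psi(1)[OF that]])
  then show ?thesis
    using lambda_UV_exists_unique bij_betw_Psi unfolding inv_Psi_def by blast
qed

end
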